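(* Let $n\ge 1$, let $P_n$ be the path with $n$ vertices, and let $H$ be any dispersable bipartite graph. Then $P_n+_Q H$ is dispersable, i.e. $\operatorname{mbt}(P_n+_Q H)=\Delta(P_n+_Q H)$.
   Context: Matching book embedding: the vertices are placed in a linear order along a spine and each edge is assigned to a page (half-plane bounded by the spine) so that no two edges on the same page cross and every vertex is incident with at most one edge on each page. $\operatorname{mbt}(G)$ is the minimum number of pages of a matching book embedding of $G$. $G$ is dispersable if $\operatorname{mbt}(G)=\Delta(G)$, where $\Delta$ denotes maximum degree. For a graph $G$, $Q(G)$ is obtained by inserting a new vertex into each edge of $G$ and then joining two new vertices whenever their edges of $G$ share an endpoint; thus $V(Q(G))=V(G)\cup E(G)$. The $Q$-sum $G+_Q H$ has vertex set $(V(G)\cup E(G))\times V(H)$. Two vertices $(u_1,u_2)$ and $(v_1,v_2)$ are adjacent if and only if either $u_1=v_1\in V(G)$ and $u_2v_2\in E(H)$, or $u_2=v_2$ and $u_1v_1\in E(Q(G))$. *)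

theory Defs
  imports Main
begin

record 'a ugraph =
  verts :: "'a set"
  edges :: "'a set set"

definition simple_graph :: "'a ugraph \<Rightarrow> bool" where
  "simple_graph G \<longleftrightarrow> finite (verts G) \<and> (\<forall>e\<in>edges G. e \<subseteq> verts G \<and> card e = 2)"

definition bipartite :: "'a ugraph \<Rightarrow> bool" where
  "bipartite G \<longleftrightarrow> (\<exists>A B. A \<union> B = verts G \<and> A \<inter> B = {} \<and>
     (\<forall>e\<in>edges G. \<exists>a\<in>A. \<exists>b\<in>B. e = {a, b}))"

definition degree :: "'a ugraph \<Rightarrow> 'a \<Rightarrow> nat" where
  "degree G v = card {e \<in> edges G. v \<in> e}"

text \<open>On \<open>nat\<close>, the supremum of a nonempty finite set is its maximum, and that of the empty
  set is \<open>0\<close>; so the graph without vertices has maximum degree \<open>0\<close>.\<close>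

definition max_degree :: "'a ugraph \<Rightarrow> nat" where
  "max_degree G = (SUP v\<in>verts G. degree G v)"

text \<open>The order of the vertices along the spine is given by injective positions \<open>pos\<close>.  Two edges
  drawn in the same half-plane cross iff their endpoints strictly alternate along the spine.  The
  relation below fixes which edge starts first; it is used for both orderings of a pair of edges.\<close>

definition crosses :: "('a \<Rightarrow> nat) \<Rightarrow> 'a set \<Rightarrow> 'a set \<Rightarrow> bool" where
  "crosses pos e f \<longleftrightarrow> (\<exists>a b c d. e = {a, b} \<and> f = {c, d} \<and>
     pos a < pos c \<and> pos c < pos b \<and> pos b < pos d)"

definition matching_book_embedding ::
  "'a ugraph \<Rightarrow> nat \<Rightarrow> ('a \<Rightarrow> nat) \<Rightarrow> ('a set \<Rightarrow> nat) \<Rightarrow> bool" where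
  "matching_book_embedding G k pos page \<longleftrightarrow>
     inj_on pos (verts G) \<and>
     (\<forall>e\<in>edges G. page e < k) \<and>
     (\<forall>e\<in>edges G. \<forall>f\<in>edges G. page e = page f \<longrightarrow> \<not> crosses pos e f) \<and>
     (\<forall>v\<in>verts G. \<forall>i<k. card {e \<in> edges G. v \<in> e \<and> page e = i} \<le> 1)"

definition mbt :: "'a ugraph \<Rightarrow> nat" where
  "mbt G = (LEAST k. \<exists>pos page. matching_book_embedding G k pos page)"

definition dispersable :: "'a ugraph \<Rightarrow> bool" where
  "dispersable G \<longleftrightarrow> mbt G = max_degree G"

definition path_graph :: "nat \<Rightarrow> nat ugraph" where
  "path_graph n = \<lparr>verts = {..<n}, edges = {{i, Suc i} | i. Suc i < n}\<rparr>"

text \<open>The vertex set \<open>V(G) \<union> E(G)\<close> is a tagged union: \<open>Inl v\<close> is an old vertex and \<open>Inr e\<close> the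
  new vertex inserted into the edge \<open>e\<close>.\<close>

definition Q_graph :: "'a ugraph \<Rightarrow> ('a + 'a set) ugraph" where
  "Q_graph G = \<lparr>verts = verts G <+> edges G,
     edges = {{Inl v, Inr e} | v e. e \<in> edges G \<and> v \<in> e} \<union>
             {{Inr e, Inr f} | e f. e \<in> edges G \<and> f \<in> edges G \<and> e \<noteq> f \<and> e \<inter> f \<noteq> {}}\<rparr>"

definition Q_sum :: "'a ugraph \<Rightarrow> 'b ugraph \<Rightarrow> (('a + 'a set) \<times> 'b) ugraph" where
  "Q_sum G H = \<lparr>verts = (verts G <+> edges G) \<times> verts H,
     edges = {{(u1, u2), (v1, v2)} | u1 u2 v1 v2.
       (u1, u2) \<in> (verts G <+> edges G) \<times> verts H \<and>
       (v1, v2) \<in> (verts G <+> edges G) \<times> verts H \<and>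
       (u1 = v1 \<and> u1 \<in> Inl ` verts G \<and> {u2, v2} \<in> edges H \<or>
        u2 = v2 \<and> {u1, v1} \<in> edges (Q_graph G))}\<rparr>"

lemma simple_graph_finite_edges:
  assumes "simple_graph G" shows "finite (edges G)"
proof (rule finite_subset)
  show "edges G \<subseteq> Pow (verts G)" using assms by (auto simp: simple_graph_def)
  show "finite (Pow (verts G))" using assms by (simp add: simple_graph_def)
qed

lemma simple_graph_path: "simple_graph (path_graph n)"
  by (auto simp: simple_graph_def path_graph_def)

lemma simple_graph_Q_graph:
  assumes "simple_graph G" shows "simple_graph (Q_graph G)"
  using assms simple_graph_finite_edges[OF assms]
  by (auto simp: simple_graph_def Q_graph_def card_insert_if)

lemma simple_graph_Q_sum:
  assumes G: "simple_graph G" and H: "simple_graph H" shows "simple_graph (Q_sum G H)"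
proof -
  have no_loop_H: "{x} \<notin> edges H" for x
    using H by (force simp: simple_graph_def)
  have no_loop_Q: "{x} \<notin> edges (Q_graph G)" for x
    using simple_graph_Q_graph[OF G] by (force simp: simple_graph_def)
  show ?thesis
    using G H simple_graph_finite_edges[OF G] no_loop_H no_loop_Q
    unfolding simple_graph_def[of "Q_sum G H"]
    by (auto simp: Q_sum_def card_insert_if simple_graph_def[of G] simple_graph_def[of H])
qed

text \<open>The minimum in \<open>mbt\<close> is attained: a finite graph can be embedded with one page per edge.\<close>

lemma matching_book_embedding_exists:
  assumes "simple_graph G"
  shows "\<exists>k pos page. matching_book_embedding G k pos page"
proof -
  obtain pos :: "'a \<Rightarrow> nat" where pos: "inj_on pos (verts G)"
    using assms finite_imp_inj_to_nat_seg by (fastforce simp: simple_graph_def)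
  obtain page :: "'a set \<Rightarrow> nat" and k
    where page: "page ` edges G = {i. i < k}" "inj_on page (edges G)"
    using finite_imp_inj_to_nat_seg[OF simple_graph_finite_edges[OF assms]] by blast
  have "\<not> crosses pos e e" for e
    by (auto simp: crosses_def doubleton_eq_iff)
  moreover have "card {e \<in> edges G. v \<in> e \<and> page e = i} \<le> 1" for v i
    using page(2) simple_graph_finite_edges[OF assms]
    by (subst One_nat_def, subst card_le_Suc0_iff_eq) (auto dest: inj_onD)
  ultimately have "matching_book_embedding G k pos page"
    using pos page by (auto simp: matching_book_embedding_def dest: inj_onD)
  then show ?thesis by blast
qed

end

theory Submission
  imports Defs
begin

text \<open>Fix an optimal matching book embedding of \<open>H\<close> and replace every vertex of \<open>H\<close> by a block
  carrying a copy of \<open>Q(P\<^sub>n)\<close>, in reversed order on one side of the bipartition.  Then the copies of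
  the edges of \<open>H\<close> keep their pages: copies of the same edge are nested.  With the block order
  \<open>v\<^bsub>n-1\<^esub>, \<dots>, v\<^sub>0, e\<^sub>0, \<dots>, e\<^bsub>n-2\<^esub>\<close>, the edges \<open>v\<^sub>i e\<^sub>i\<close> are nested and need one extra page,
  as do the edges \<open>v\<^bsub>i+1\<^esub> e\<^sub>i\<close>.  The edges \<open>e\<^sub>i e\<^bsub>i+1\<^esub>\<close> join consecutive vertices, which carry no
  edges of \<open>H\<close>, so they can alternate between two pages already used for \<open>H\<close>.  For \<open>n \<ge> 3\<close> this
  attains the maximum degree.  For \<open>n = 2\<close> only one extra page is allowed: with the block order
  \<open>v\<^sub>0, e\<^sub>0, v\<^sub>1\<close>, the edge \<open>v\<^sub>0 e\<^sub>0\<close> goes to the extra page, the edge \<open>e\<^sub>0 v\<^sub>1\<close> to page \<open>0\<close>, and the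
  copies at \<open>v\<^sub>1\<close> of the edges of \<open>H\<close> on page \<open>0\<close> move to the extra page.\<close>

section \<open>Simple graphs, matching book embeddings and the degree bound\<close>

lemma simple_graph_edgeE:
  assumes "simple_graph G" "e \<in> edges G"
  obtains a b where "e = {a, b}" "a \<noteq> b" "a \<in> verts G" "b \<in> verts G"
proof -
  have "e \<subseteq> verts G" "card e = 2" using assms by (auto simp: simple_graph_def)
  then show ?thesis using that by (auto simp: card_2_iff)
qed

lemma simple_graph_edge_neq:
  assumes "simple_graph G" "{a, b} \<in> edges G"
  shows "a \<noteq> b"
  using assms by (force simp: simple_graph_def)

lemma simple_graph_edge_verts:
  assumes "simple_graph G" "e \<in> edges G" "v \<in> e"
  shows "v \<in> verts G"
  using assms by (auto simp: simple_graph_def)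

lemma matching_book_embedding_iff:
  assumes "simple_graph G"
  shows "matching_book_embedding G k pos page \<longleftrightarrow>
    inj_on pos (verts G) \<and>
    (\<forall>e\<in>edges G. page e < k) \<and>
    (\<forall>e\<in>edges G. \<forall>f\<in>edges G. page e = page f \<longrightarrow> \<not> crosses pos e f) \<and>
    (\<forall>e\<in>edges G. \<forall>f\<in>edges G. \<forall>v. page e = page f \<longrightarrow> v \<in> e \<longrightarrow> v \<in> f \<longrightarrow> e = f)"
proof -
  have *: "card {e \<in> edges G. v \<in> e \<and> page e = i} \<le> 1 \<longleftrightarrow>
    (\<forall>e\<in>edges G. \<forall>f\<in>edges G. v \<in> e \<longrightarrow> v \<in> f \<longrightarrow> page e = i \<longrightarrow> page f = i \<longrightarrow> e = f)" for v i
    using simple_graph_finite_edges[OF assms] unfolding One_nat_def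
    by (subst card_le_Suc0_iff_eq) auto
  show ?thesis
    unfolding matching_book_embedding_def *
    using simple_graph_edge_verts[OF assms] by (intro conj_cong refl) (metis (no_types))
qed

text \<open>Edges at a common vertex lie on distinct pages, so \<open>page\<close> injects them into
  the \<open>k\<close> pages.\<close>

lemma degree_le_pages:
  assumes "simple_graph G" "matching_book_embedding G k pos page" "v \<in> verts G"
  shows "degree G v \<le> k"
proof -
  have "inj_on page {e \<in> edges G. v \<in> e}"
    using assms(2) unfolding matching_book_embedding_iff[OF assms(1)] by (intro inj_onI) blast
  moreover have "page ` {e \<in> edges G. v \<in> e} \<subseteq> {..<k}"
    using assms unfolding matching_book_embedding_def by auto
  ultimately have "card {e \<in> edges G. v \<in> e} \<le> card {..<k}"
    by (meson card_inj_on_le finite_lessThan)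
  then show ?thesis by (simp add: degree_def)
qed

lemma degree_le_max_degree:
  assumes "simple_graph G" "v \<in> verts G"
  shows "degree G v \<le> max_degree G"
  unfolding max_degree_def
  using assms by (intro cSUP_upper) (auto simp: simple_graph_def)

lemma max_degree_attained:
  assumes "simple_graph G" "verts G \<noteq> {}"
  obtains v where "v \<in> verts G" "degree G v = max_degree G"
proof -
  have "Max (degree G ` verts G) \<in> degree G ` verts G"
    using assms by (intro Max_in) (auto simp: simple_graph_def)
  moreover have "max_degree G = Max (degree G ` verts G)"
    unfolding max_degree_def using assms by (intro cSup_eq_Max) (auto simp: simple_graph_def)
  ultimately show ?thesis using that by auto
qed

lemma max_degree_le_pages:
  assumes "simple_graph G" "matching_book_embedding G k pos page"
  shows "max_degree G \<le> k"
proof (cases "verts G = {}")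
  case True
  then show ?thesis by (simp add: max_degree_def)
next
  case False
  then show ?thesis using max_degree_attained[OF assms(1)] degree_le_pages[OF assms] by metis
qed

text \<open>The maximum degree bounds the page number from below, so one embedding with few enough
  pages suffices.\<close>

lemma dispersableI:
  assumes "simple_graph G" "matching_book_embedding G k pos page" "k \<le> max_degree G"
  shows "dispersable G"
  unfolding dispersable_def mbt_def
proof (rule Least_equality)
  have "k = max_degree G"
    using assms max_degree_le_pages[OF assms(1,2)] by simp
  then show "\<exists>pos page. matching_book_embedding G (max_degree G) pos page"
    using assms(2) by blast
qed (use max_degree_le_pages[OF assms(1)] in blast)

lemma dispersable_embedding:
  assumes "simple_graph G" "dispersable G"
  obtains pos page where "matching_book_embedding G (max_degree G) pos page"
proof -
  have "\<exists>pos page. matching_book_embedding G (mbt G) pos page"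
    unfolding mbt_def by (rule LeastI_ex[OF matching_book_embedding_exists[OF assms(1)]])
  then show ?thesis using assms(2) that unfolding dispersable_def by auto
qed

section \<open>Edges and vertex degrees of the Q-sum\<close>

lemma degree_eq_card_neighbours:
  assumes "simple_graph G"
  shows "degree G v = card {w. {v, w} \<in> edges G}"
proof -
  have "bij_betw (\<lambda>w. {v, w}) {w. {v, w} \<in> edges G} {e \<in> edges G. v \<in> e}"
    unfolding bij_betw_def
  proof (intro conjI equalityI subsetI)
    show "inj_on (\<lambda>w. {v, w}) {w. {v, w} \<in> edges G}"
      by (auto simp: inj_on_def doubleton_eq_iff)
    fix e assume "e \<in> {e \<in> edges G. v \<in> e}"
    then obtain a b where "e \<in> edges G" "e = {a, b}" "v = a \<or> v = b"
      using simple_graph_edgeE[OF assms, of e] by blast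
    then show "e \<in> (\<lambda>w. {v, w}) ` {w. {v, w} \<in> edges G}"
      by (auto simp: insert_commute)
  qed auto
  then show ?thesis by (simp add: degree_def bij_betw_same_card)
qed

lemma finite_neighbours:
  assumes "simple_graph G"
  shows "finite {w. {v, w} \<in> edges G}"
proof (rule finite_subset)
  show "{w. {v, w} \<in> edges G} \<subseteq> verts G"
    using simple_graph_edge_verts[OF assms] by auto
  show "finite (verts G)" using assms by (simp add: simple_graph_def)
qed

lemma card_le_degree:
  assumes "simple_graph G" "\<And>w. w \<in> W \<Longrightarrow> {v, w} \<in> edges G"
  shows "card W \<le> degree G v"
  unfolding degree_eq_card_neighbours[OF assms(1)]
  using assms(2) finite_neighbours[OF assms(1)] by (intro card_mono) auto

text \<open>Splits the edges into copies of edges of \<open>H\<close> and copies of edges of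
  \<open>Q_graph G\<close>. Membership of the endpoints follows from simplicity.\<close>

lemma edges_Q_sum:
  assumes G: "simple_graph G" and H: "simple_graph H"
  shows "edges (Q_sum G H) =
    {{(Inl v, a), (Inl v, b)} | v a b. v \<in> verts G \<and> {a, b} \<in> edges H} \<union>
    {{(x, h), (y, h)} | x y h. h \<in> verts H \<and> {x, y} \<in> edges (Q_graph G)}" (is "_ = ?R")
proof
  show "edges (Q_sum G H) \<subseteq> ?R" unfolding Q_sum_def by auto
  have vQ: "verts (Q_graph G) = verts G <+> edges G" by (simp add: Q_graph_def)
  have "{(Inl v, a), (Inl v, b)} \<in> edges (Q_sum G H)"
    if "v \<in> verts G" "{a, b} \<in> edges H" for v a b
  proof -
    have "a \<in> verts H" "b \<in> verts H" using simple_graph_edge_verts[OF H that(2)] by auto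
    with that show ?thesis
      unfolding Q_sum_def ugraph.simps mem_Collect_eq
      by - (rule exI[of _ "Inl v"], rule exI[of _ a], rule exI[of _ "Inl v"],
          rule exI[of _ b], auto)
  qed
  moreover have "{(x, h), (y, h)} \<in> edges (Q_sum G H)"
    if "h \<in> verts H" "{x, y} \<in> edges (Q_graph G)" for x y h
  proof -
    have "x \<in> verts G <+> edges G" "y \<in> verts G <+> edges G"
      using simple_graph_edge_verts[OF simple_graph_Q_graph[OF G] that(2)] vQ by auto
    with that show ?thesis
      unfolding Q_sum_def ugraph.simps mem_Collect_eq
      by - (rule exI[of _ x], rule exI[of _ h], rule exI[of _ y], rule exI[of _ h], auto)
  qed
  ultimately show "?R \<subseteq> edges (Q_sum G H)" by blast
qed

text \<open>The neighbours inherited from \<open>H\<close> and those inherited from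
  \<open>Q_graph G\<close> are disjoint, since \<open>H\<close> has no loop at
  \<open>h\<close>.\<close>

lemma degree_Q_sum_Inl:
  assumes G: "simple_graph G" and H: "simple_graph H" and "v \<in> verts G" "h \<in> verts H"
  shows "degree H h + degree (Q_graph G) (Inl v) \<le> degree (Q_sum G H) (Inl v, h)"
proof -
  let ?A = "{w. {h, w} \<in> edges H}" and ?B = "{x. {Inl v, x} \<in> edges (Q_graph G)}"
  note Q = simple_graph_Q_graph[OF G]
  have "{Inl v} \<times> ?A \<inter> ?B \<times> {h} = {}"
    using simple_graph_edge_neq[OF H] by blast
  then have "card ({Inl v} \<times> ?A \<union> ?B \<times> {h}) = card ?A + card ?B"
    using finite_neighbours[OF H] finite_neighbours[OF Q]
    by (subst card_Un_disjoint) (auto simp: card_cartesian_product)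
  moreover have "card ({Inl v} \<times> ?A \<union> ?B \<times> {h}) \<le> degree (Q_sum G H) (Inl v, h)"
    using assms by (intro card_le_degree simple_graph_Q_sum) (auto simp: edges_Q_sum)
  ultimately show ?thesis
    by (simp add: degree_eq_card_neighbours[OF H] degree_eq_card_neighbours[OF Q])
qed

text \<open>Applied to the inserted vertices, this supplies the degree bound when \<open>H\<close>
  has small maximum degree.\<close>

lemma degree_Q_graph_le_Q_sum:
  assumes G: "simple_graph G" and H: "simple_graph H" and "h \<in> verts H"
  shows "degree (Q_graph G) x \<le> degree (Q_sum G H) (x, h)"
proof -
  let ?B = "{y. {x, y} \<in> edges (Q_graph G)}"
  have "card (?B \<times> {h}) \<le> degree (Q_sum G H) (x, h)"
    using assms by (intro card_le_degree simple_graph_Q_sum) (auto simp: edges_Q_sum)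
  then show ?thesis
    by (simp add: degree_eq_card_neighbours[OF simple_graph_Q_graph[OF G]] card_cartesian_product)
qed

section \<open>Combining embeddings of \<open>H\<close> and \<open>Q_graph G\<close>\<close>

lemma crosses_doubleton:
  "crosses pos {p, q} {r, t} \<longleftrightarrow>
    pos p < pos r \<and> pos r < pos q \<and> pos q < pos t \<or>
    pos q < pos r \<and> pos r < pos p \<and> pos p < pos t \<or>
    pos p < pos t \<and> pos t < pos q \<and> pos q < pos r \<or>
    pos q < pos t \<and> pos t < pos p \<and> pos p < pos r"
  unfolding crosses_def doubleton_eq_iff by blast

text \<open>\<open>c v\<close> relabels the pages of the copy of \<open>H\<close> at \<open>v\<close>; by \<open>c_inj\<close>, every page receives edges
  from at most one page of \<open>H\<close>.\<close>

lemma Q_sum_embedding: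
  fixes G :: "'a ugraph" and H :: "'b ugraph"
  assumes G: "simple_graph G" and H: "simple_graph H" and bip: "bipartite H"
    and emb_H: "matching_book_embedding H D posH pageH"
    and emb_Q: "matching_book_embedding (Q_graph G) k posQ pageQ"
    and c_less: "\<And>v i. v \<in> verts G \<Longrightarrow> i < D \<Longrightarrow> c v i < k"
    and c_inj: "\<And>v w i j. \<lbrakk>v \<in> verts G; w \<in> verts G; i < D; j < D; c v i = c w j\<rbrakk> \<Longrightarrow> i = j"
    and c_free: "\<And>v i x y. \<lbrakk>v \<in> verts G; i < D; {x, y} \<in> edges (Q_graph G); pageQ {x, y} = c v i\<rbrakk>
       \<Longrightarrow> Inl v \<noteq> x \<and> \<not> (posQ x < posQ (Inl v) \<and> posQ (Inl v) < posQ y)"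
  shows "\<exists>pos page. matching_book_embedding (Q_sum G H) k pos page"
proof -
  obtain A B where AB: "A \<union> B = verts H" "A \<inter> B = {}"
    "\<forall>e\<in>edges H. \<exists>a\<in>A. \<exists>b\<in>B. e = {a, b}"
    using bip unfolding bipartite_def by blast
  have bip_edge: "a \<in> A \<longleftrightarrow> b \<notin> A" if "{a, b} \<in> edges H" for a b
    using AB that by (metis disjoint_iff doubleton_eq_iff)
  note Q = simple_graph_Q_graph[OF G]
  note H_emb = emb_H[unfolded matching_book_embedding_iff[OF H]]
  note Q_emb = emb_Q[unfolded matching_book_embedding_iff[OF Q]]
  have vQ: "verts (Q_graph G) = verts G <+> edges G" by (simp add: Q_graph_def)
  have "finite (posQ ` verts (Q_graph G))" using Q by (simp add: simple_graph_def)
  then obtain N where N: "\<And>x. x \<in> verts (Q_graph G) \<Longrightarrow> posQ x < N"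
    by (metis finite_nat_set_iff_bounded image_eqI)
  \<comment> \<open>Offset inside the block of \<open>h\<close>, reversed on side \<open>A\<close>.
    \<open>N\<close> exceeds every position in \<open>posQ\<close>, so blocks of width
    \<open>N\<close> do not overlap.\<close>
  define s where "s h x = (if h \<in> A then posQ x else N - 1 - posQ x)" for h :: 'b and x
  define pos where "pos = (\<lambda>(x, h). posH h * N + s h x)"
  define page where "page E = (if \<exists>v. fst ` E = {Inl v}
      then c (THE v. fst ` E = {Inl v}) (pageH (snd ` E)) else pageQ (fst ` E))"
    for E :: "(('a + 'a set) \<times> 'b) set"
  have s_less: "s h x < N" if "x \<in> verts (Q_graph G)" for h x
    using N[OF that] by (auto simp: s_def)
  have block_less: "pos (x, h) < pos (y, g)"
    if "x \<in> verts (Q_graph G)" "posH h < posH g" for x y h g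
  proof -
    have "posH h * N + s h x < Suc (posH h) * N" using s_less[OF that(1)] by simp
    also have "\<dots> \<le> posH g * N" using that(2) by (intro mult_le_mono1) simp
    finally show ?thesis by (simp add: pos_def)
  qed
  have pos_less: "pos (x, h) < pos (y, g) \<longleftrightarrow>
      posH h < posH g \<or> h = g \<and> (if h \<in> A then posQ x < posQ y else posQ y < posQ x)"
    if "x \<in> verts (Q_graph G)" "y \<in> verts (Q_graph G)" "h \<in> verts H" "g \<in> verts H" for x y h g
  proof -
    have "posH h = posH g \<Longrightarrow> h = g" using H_emb that by (meson inj_onD)
    then consider "posH h < posH g" | "posH g < posH h" | "h = g" by linarith
    then show ?thesis
    proof cases
      case 3
      then show ?thesis using N[OF that(1)] N[OF that(2)] by (auto simp: pos_def s_def)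
    next
      case 1
      then show ?thesis using block_less[OF that(1)] by simp
    next
      case 2
      then show ?thesis using block_less[OF that(2) 2, of x] by auto
    qed
  qed
  have Inl_v: "Inl v \<in> verts (Q_graph G)" if "v \<in> verts G" for v
    using that vQ by auto
  have Hv: "a \<in> verts H" "b \<in> verts H" "a \<noteq> b" if "{a, b} \<in> edges H" for a b
    using simple_graph_edge_verts[OF H that] simple_graph_edge_neq[OF H that] by auto
  have Qv: "x \<in> verts (Q_graph G)" "y \<in> verts (Q_graph G)" "x \<noteq> y"
    if "{x, y} \<in> edges (Q_graph G)" for x y
    using simple_graph_edge_verts[OF Q that] simple_graph_edge_neq[OF Q that] by auto
  have page_H: "page {(Inl v, a), (Inl v, b)} = c v (pageH {a, b})" for v a b
    unfolding page_def by simp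
  have page_Q: "page {(x, h), (y, h)} = pageQ {x, y}" if "{x, y} \<in> edges (Q_graph G)" for x y h
    using Qv(3)[OF that] unfolding page_def by auto
  have page_less: "pageH e < D" if "e \<in> edges H" for e using H_emb that by blast
  have free: "Inl v \<noteq> x" "Inl v \<noteq> y"
      "\<not> (posQ x < posQ (Inl v) \<and> posQ (Inl v) < posQ y)"
      "\<not> (posQ y < posQ (Inl v) \<and> posQ (Inl v) < posQ x)"
    if "v \<in> verts G" "{a, b} \<in> edges H" "{x, y} \<in> edges (Q_graph G)"
      "pageQ {x, y} = c v (pageH {a, b})" for v a b x y
    using c_free[OF that(1) page_less[OF that(2)] that(3,4)]
      c_free[OF that(1) page_less[OF that(2)], of y x] that(3,4) by (auto simp: insert_commute)
  have same_page_H: "pageH {a, b} = pageH {a', b'}"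
    if "v \<in> verts G" "v' \<in> verts G" "{a, b} \<in> edges H" "{a', b'} \<in> edges H"
      "c v (pageH {a, b}) = c v' (pageH {a', b'})" for v v' a b a' b'
    using c_inj[OF that(1,2)] page_less that by blast

  \<comment> \<open>Whatever lies between two vertices of one block is in that block, and
    betweenness survives reversal.\<close>
  have block: "g = h \<and> (posQ x < posQ z \<and> posQ z < posQ y \<or> posQ y < posQ z \<and> posQ z < posQ x)"
    if "x \<in> verts (Q_graph G)" "y \<in> verts (Q_graph G)" "z \<in> verts (Q_graph G)"
      "h \<in> verts H" "g \<in> verts H" "pos (x, h) < pos (z, g)" "pos (z, g) < pos (y, h)" for x y z h g
    using that by (auto simp: pos_less split: if_splits)

  have cross_HH: "\<not> crosses pos {(Inl v, a), (Inl v, b)} {(Inl v', a'), (Inl v', b')}"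
    if v: "v \<in> verts G" "v' \<in> verts G" and ab: "{a, b} \<in> edges H" "{a', b'} \<in> edges H"
      and p: "c v (pageH {a, b}) = c v' (pageH {a', b'})" for v v' a b a' b'
  proof (cases "{a, b} = {a', b'}")
    \<comment> \<open>Two copies of the same edge of \<open>H\<close>: the blocks of its ends are
      ordered oppositely, so the copies are nested.\<close>
    case True
    then show ?thesis
      using Hv[OF ab(1)] bip_edge[OF ab(1)] Inl_v[OF v(1)] Inl_v[OF v(2)]
      unfolding crosses_doubleton doubleton_eq_iff by (auto simp: pos_less split: if_splits)
  next
    case False
    \<comment> \<open>Distinct edges of \<open>H\<close> on one page share no endpoint, so the four
      ends lie in distinct blocks, ordered as by \<open>posH\<close>.\<close>
    have pp: "pageH {a, b} = pageH {a', b'}" by (rule same_page_H[OF v ab p])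
    have "a \<noteq> a'" "a \<noteq> b'" "b \<noteq> a'" "b \<noteq> b'"
      using H_emb ab pp False by blast+
    moreover have "\<not> crosses posH {a, b} {a', b'}" using H_emb ab pp by blast
    ultimately show ?thesis
      using Hv[OF ab(1)] Hv[OF ab(2)] Inl_v[OF v(1)] Inl_v[OF v(2)]
      unfolding crosses_doubleton by (auto simp: pos_less)
  qed
  have cross_QQ: "\<not> crosses pos {(x, h), (y, h)} {(x', h'), (y', h')}"
    if h: "h \<in> verts H" "h' \<in> verts H"
      and xy: "{x, y} \<in> edges (Q_graph G)" "{x', y'} \<in> edges (Q_graph G)"
      and p: "pageQ {x, y} = pageQ {x', y'}" for x y x' y' h h'
  proof -
    note mem = Qv(1,2)[OF xy(1)] Qv(1,2)[OF xy(2)]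
    have no_cross: "\<not> crosses posQ {x, y} {x', y'}" "\<not> crosses posQ {x', y'} {x, y}"
      using Q_emb xy p by metis+
    have same_block: "pos (z, h) < pos (w, h) \<longleftrightarrow> (if h \<in> A then posQ z < posQ w else posQ w < posQ z)"
      if "z \<in> verts (Q_graph G)" "w \<in> verts (Q_graph G)" for z w
      using pos_less[OF that h(1) h(1)] by simp
    show ?thesis
    proof
      assume cross: "crosses pos {(x, h), (y, h)} {(x', h'), (y', h')}"
      \<comment> \<open>In a crossing, an end of the second edge lies between the ends of the first,
        hence in the same block.\<close>
      then have "h' = h"
        using block[of x y _ h h'] block[of y x _ h h'] mem h
        unfolding crosses_doubleton by metis
      \<comment> \<open>Reversing a block exchanges which edge starts first, hence the
        disjunction.\<close>
      then have "crosses posQ {x, y} {x', y'} \<or> crosses posQ {x', y'} {x, y}"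
        using cross unfolding crosses_doubleton
        by (cases "h \<in> A") (simp_all only: same_block mem if_True if_False, blast+)
      then show False using no_cross by blast
    qed
  qed
  \<comment> \<open>A crossing would put \<open>Inl v\<close> strictly between \<open>x\<close> and
    \<open>y\<close> in the block of \<open>h\<close>, which \<open>free\<close> forbids.\<close>
  have cross_HQ: "\<not> crosses pos {(Inl v, a), (Inl v, b)} {(x, h), (y, h)}"
      "\<not> crosses pos {(x, h), (y, h)} {(Inl v, a), (Inl v, b)}"
    if v: "v \<in> verts G" "{a, b} \<in> edges H" and h: "h \<in> verts H" and xy: "{x, y} \<in> edges (Q_graph G)"
      and p: "pageQ {x, y} = c v (pageH {a, b})" for v a b x y h
    using free(3,4)[OF v xy p] Qv(1,2)[OF xy] Hv(1,2)[OF v(2)] Inl_v[OF v(1)] h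
      block[of x y "Inl v" h] block[of y x "Inl v" h]
    unfolding crosses_doubleton by metis+

  have edge_cases: "(\<exists>v a b. v \<in> verts G \<and> {a, b} \<in> edges H \<and> E = {(Inl v, a), (Inl v, b)} \<and>
        page E = c v (pageH {a, b})) \<or>
      (\<exists>x y h. h \<in> verts H \<and> {x, y} \<in> edges (Q_graph G) \<and> E = {(x, h), (y, h)} \<and>
        page E = pageQ {x, y})" if "E \<in> edges (Q_sum G H)" for E
    using that page_H page_Q unfolding edges_Q_sum[OF G H] by fast

  have "inj_on pos (verts (Q_sum G H))"
  proof (rule inj_onI)
    fix p q assume pq: "p \<in> verts (Q_sum G H)" "q \<in> verts (Q_sum G H)" "pos p = pos q"
    obtain x h y g where [simp]: "p = (x, h)" "q = (y, g)" by (cases p, cases q)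
    have mem: "x \<in> verts (Q_graph G)" "y \<in> verts (Q_graph G)" "h \<in> verts H" "g \<in> verts H"
      using pq vQ by (auto simp: Q_sum_def)
    have "\<not> pos (x, h) < pos (y, g)" "\<not> pos (y, g) < pos (x, h)" using pq by auto
    then have "posH h = posH g" using pos_less mem by (meson linorder_neqE_nat)
    then have "h = g" using H_emb mem by (meson inj_onD)
    then have "posQ x = posQ y"
      using \<open>\<not> pos (x, h) < pos (y, g)\<close> \<open>\<not> pos (y, g) < pos (x, h)\<close> mem
      by (auto simp: pos_less split: if_splits)
    then show "p = q" using Q_emb mem \<open>h = g\<close> by (auto dest: inj_onD)
  qed
  moreover have "page E < k" if "E \<in> edges (Q_sum G H)" for E
    using edge_cases[OF that] Q_emb c_less page_less by metis
  moreover have "\<not> crosses pos E F"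
    if "E \<in> edges (Q_sum G H)" "F \<in> edges (Q_sum G H)" "page E = page F" for E F
    using edge_cases[OF that(1)] edge_cases[OF that(2)] that(3)
    by (elim disjE exE conjE) (simp_all add: cross_HH cross_QQ cross_HQ)
  moreover have "E = F"
    if "E \<in> edges (Q_sum G H)" "F \<in> edges (Q_sum G H)" "page E = page F" "w \<in> E" "w \<in> F" for E F w
    using edge_cases[OF that(1)] edge_cases[OF that(2)]
  proof (elim disjE exE conjE)
    fix v a b v' a' b'
    assume *: "v \<in> verts G" "{a, b} \<in> edges H" "E = {(Inl v, a), (Inl v, b)}"
      "page E = c v (pageH {a, b})" "v' \<in> verts G" "{a', b'} \<in> edges H"
      "F = {(Inl v', a'), (Inl v', b')}" "page F = c v' (pageH {a', b'})"
    then have "pageH {a, b} = pageH {a', b'}" using same_page_H that(3) by metis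
    moreover have "v = v'" "snd w \<in> {a, b}" "snd w \<in> {a', b'}" using * that(4,5) by auto
    ultimately have "{a, b} = {a', b'}" using H_emb * by metis
    then show ?thesis using * \<open>v = v'\<close> by (auto simp: doubleton_eq_iff)
  next
    fix x y h x' y' h'
    assume *: "h \<in> verts H" "{x, y} \<in> edges (Q_graph G)" "E = {(x, h), (y, h)}"
      "page E = pageQ {x, y}" "h' \<in> verts H" "{x', y'} \<in> edges (Q_graph G)"
      "F = {(x', h'), (y', h')}" "page F = pageQ {x', y'}"
    moreover have "h = h'" "fst w \<in> {x, y}" "fst w \<in> {x', y'}" using * that(4,5) by auto
    ultimately have "{x, y} = {x', y'}" using Q_emb that(3) by metis
    then show ?thesis using * \<open>h = h'\<close> by (auto simp: doubleton_eq_iff)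
  next
    fix v a b x y h
    assume "v \<in> verts G" "{a, b} \<in> edges H" "E = {(Inl v, a), (Inl v, b)}"
      "page E = c v (pageH {a, b})" "h \<in> verts H" "{x, y} \<in> edges (Q_graph G)"
      "F = {(x, h), (y, h)}" "page F = pageQ {x, y}"
    then show ?thesis using free[of v a b x y] that by auto
  next
    fix v a b x y h
    assume "v \<in> verts G" "{a, b} \<in> edges H" "F = {(Inl v, a), (Inl v, b)}"
      "page F = c v (pageH {a, b})" "h \<in> verts H" "{x, y} \<in> edges (Q_graph G)"
      "E = {(x, h), (y, h)}" "page E = pageQ {x, y}"
    then show ?thesis using free[of v a b x y] that by auto
  qed
  ultimately have "matching_book_embedding (Q_sum G H) k pos page"
    unfolding matching_book_embedding_iff[OF simple_graph_Q_sum[OF G H]] by blast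
  then show ?thesis by blast
qed

section \<open>Lower bounds for the maximum degree of the Q-sum\<close>

lemma max_degree_Q_sum_Inl:
  assumes G: "simple_graph G" and H: "simple_graph H" and "verts H \<noteq> {}" "v \<in> verts G"
  shows "max_degree H + degree (Q_graph G) (Inl v) \<le> max_degree (Q_sum G H)"
proof -
  obtain h where h: "h \<in> verts H" "degree H h = max_degree H"
    using max_degree_attained[OF H] assms by blast
  have "(Inl v, h) \<in> verts (Q_sum G H)" using assms h by (auto simp: Q_sum_def)
  then show ?thesis
    using degree_Q_sum_Inl[OF G H assms(4) h(1)] h(2)
      degree_le_max_degree[OF simple_graph_Q_sum[OF G H], of "(Inl v, h)"] by simp
qed

lemma max_degree_Q_sum_Inr:
  assumes G: "simple_graph G" and H: "simple_graph H" and "verts H \<noteq> {}" "e \<in> edges G"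
  shows "degree (Q_graph G) (Inr e) \<le> max_degree (Q_sum G H)"
proof -
  obtain h where h: "h \<in> verts H" using assms by blast
  have "(Inr e, h) \<in> verts (Q_sum G H)" using assms h by (auto simp: Q_sum_def)
  then show ?thesis
    using degree_Q_graph_le_Q_sum[OF G H h, of "Inr e"]
      degree_le_max_degree[OF simple_graph_Q_sum[OF G H], of "(Inr e, h)"] by simp
qed

section \<open>The graph \<open>Q(P_n)\<close> and its embedding for long paths\<close>

lemma edges_Q_path:
  "edges (Q_graph (path_graph n)) =
    {{Inl i, Inr {i, Suc i}} | i. Suc i < n} \<union>
    {{Inl (Suc i), Inr {i, Suc i}} | i. Suc i < n} \<union>
    {{Inr {i, Suc i}, Inr {Suc i, Suc (Suc i)}} | i. Suc (Suc i) < n}" (is "_ = ?A \<union> ?B \<union> ?C")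
proof
  show "edges (Q_graph (path_graph n)) \<subseteq> ?A \<union> ?B \<union> ?C"
  proof
    fix E assume "E \<in> edges (Q_graph (path_graph n))"
    then consider (VE) v i where "E = {Inl v, Inr {i, Suc i}}" "v \<in> {i, Suc i}" "Suc i < n"
      | (EE) i j where "E = {Inr {i, Suc i}, Inr {j, Suc j}}" "Suc i < n" "Suc j < n"
          "i \<noteq> j" "{i, Suc i} \<inter> {j, Suc j} \<noteq> {}"
      unfolding Q_graph_def path_graph_def ugraph.simps by blast
    then show "E \<in> ?A \<union> ?B \<union> ?C"
    proof cases
      case VE
      then show ?thesis by auto
    next
      case EE
      then have "j = Suc i \<or> i = Suc j" by auto
      then show ?thesis using EE by (auto simp: insert_commute)
    qed
  qed
  have "{Inl v, Inr {i, Suc i}} \<in> edges (Q_graph (path_graph n))"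
    if "v \<in> {i, Suc i}" "Suc i < n" for v i
    using that unfolding Q_graph_def path_graph_def by auto
  moreover have "{Inr {i, Suc i}, Inr {Suc i, Suc (Suc i)}} \<in> edges (Q_graph (path_graph n))"
    if "Suc (Suc i) < n" for i
  proof -
    have "{i, Suc i} \<in> edges (path_graph n)" "{Suc i, Suc (Suc i)} \<in> edges (path_graph n)"
      using that by (auto simp: path_graph_def)
    moreover have "{i, Suc i} \<noteq> {Suc i, Suc (Suc i)}" "{i, Suc i} \<inter> {Suc i, Suc (Suc i)} \<noteq> {}"
      by (auto simp: doubleton_eq_iff)
    ultimately show ?thesis unfolding Q_graph_def by auto
  qed
  ultimately show "?A \<union> ?B \<union> ?C \<subseteq> edges (Q_graph (path_graph n))" by auto
qed

lemma verts_Q_path: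
  "verts (Q_graph (path_graph n)) = {..<n} <+> {{i, Suc i} | i. Suc i < n}"
  by (simp add: Q_graph_def path_graph_def)

text \<open>The order \<open>v\<^bsub>n-1\<^esub>, \<dots>, v\<^sub>0, e\<^sub>0, \<dots>, e\<^bsub>n-2\<^esub>\<close> of \<open>Q(P\<^sub>n)\<close>, where \<open>e\<^sub>i\<close> is the
  vertex inserted between \<open>v\<^sub>i\<close> and \<open>v\<^bsub>i+1\<^esub>\<close>.\<close>

definition fan_pos :: "nat \<Rightarrow> nat + nat set \<Rightarrow> nat" where
  "fan_pos n x = (case x of Inl i \<Rightarrow> n - 1 - i | Inr e \<Rightarrow> n + Min e)"

text \<open>The edges \<open>v\<^sub>i e\<^sub>i\<close> have position sum \<open>2n - 1\<close>, the edges \<open>v\<^bsub>i+1\<^esub> e\<^sub>i\<close> have position sum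
  \<open>2n - 2\<close>, and the edge \<open>e\<^sub>i e\<^bsub>i+1\<^esub>\<close> has position sum \<open>2n + 2i + 1\<close>.  Edges with equal position
  sums are nested.\<close>

definition fan_page :: "nat \<Rightarrow> nat \<Rightarrow> (nat + nat set) set \<Rightarrow> nat" where
  "fan_page n M S = (let s = sum (fan_pos n) S in
     if s = 2 * n - 1 then M else if s = 2 * n - 2 then M + 1 else (s - 2 * n) div 2 mod 2)"

lemma fan_page_simps:
  "Suc i < n \<Longrightarrow> fan_page n M {Inl i, Inr {i, Suc i}} = M"
  "Suc i < n \<Longrightarrow> fan_page n M {Inl (Suc i), Inr {i, Suc i}} = Suc M"
  "fan_page n M {Inr {i, Suc i}, Inr {Suc i, Suc (Suc i)}} = i mod 2"
  by (auto simp: fan_page_def fan_pos_def doubleton_eq_iff Let_def)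

text \<open>The edges between inserted vertices must stay on pages below \<open>M\<close>. There is
  one such edge for \<open>n = 3\<close>, needing page \<open>0\<close> only; from
  \<open>n = 4\<close> on, pages \<open>0\<close> and \<open>1\<close> alternate.\<close>

lemma fan_embedding:
  assumes M: "n \<ge> 3 \<Longrightarrow> M \<ge> 1" "n \<ge> 4 \<Longrightarrow> M \<ge> 2"
  shows "matching_book_embedding (Q_graph (path_graph n)) (M + 2) (fan_pos n) (fan_page n M)"
  unfolding matching_book_embedding_iff[OF simple_graph_Q_graph[OF simple_graph_path]]
proof (intro conjI ballI allI impI)
  show "inj_on (fan_pos n) (verts (Q_graph (path_graph n)))"
    unfolding verts_Q_path by (auto simp: inj_on_def fan_pos_def)
  have mod_less: "i mod 2 < M" if "Suc (Suc i) < n" for i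
  proof (cases "i = 0")
    case True
    then show ?thesis using M(1) that by simp
  next
    case False
    then have "M \<ge> 2" using M(2) that by simp
    then show ?thesis by (simp add: order.strict_trans2[OF mod_less_divisor])
  qed
  define low where "low e \<longleftrightarrow> (\<exists>i. Suc i < n \<and> e = {Inl i, Inr {i, Suc i}})" for e
  define high where "high e \<longleftrightarrow> (\<exists>i. Suc i < n \<and> e = {Inl (Suc i), Inr {i, Suc i}})" for e
  define rim :: "nat \<Rightarrow> (nat + nat set) set \<Rightarrow> bool"
    where "rim i e \<longleftrightarrow> e = {Inr {i, Suc i}, Inr {Suc i, Suc (Suc i)}}" for i e
  have edge_cases: "low e \<and> fan_page n M e = M \<or> high e \<and> fan_page n M e = Suc M \<or>
      (\<exists>i. rim i e \<and> fan_page n M e = i mod 2 \<and> i mod 2 < M)"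
    if "e \<in> edges (Q_graph (path_graph n))" for e
    using that unfolding edges_Q_path
  proof (elim UnE CollectE exE conjE)
    fix i assume "e = {Inl i, Inr {i, Suc i}}" "Suc i < n"
    then show ?thesis using fan_page_simps(1) unfolding low_def by blast
  next
    fix i assume "e = {Inl (Suc i), Inr {i, Suc i}}" "Suc i < n"
    then show ?thesis using fan_page_simps(2) unfolding high_def by blast
  next
    fix i assume "e = {Inr {i, Suc i}, Inr {Suc i, Suc (Suc i)}}" "Suc (Suc i) < n"
    then show ?thesis using fan_page_simps(3) mod_less unfolding rim_def by metis
  qed
  fix e assume e: "e \<in> edges (Q_graph (path_graph n))"
  show "fan_page n M e < M + 2"
    using edge_cases[OF e] by auto
  fix f assume f: "f \<in> edges (Q_graph (path_graph n))" and same: "fan_page n M e = fan_page n M f"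
  have "low e \<and> low f \<or> high e \<and> high f \<or> (\<exists>i j. i mod 2 = j mod 2 \<and> rim i e \<and> rim j f)"
    using edge_cases[OF e] edge_cases[OF f] same by auto
  note split = this[unfolded low_def high_def rim_def]
  \<comment> \<open>Edges of the first two kinds are nested; those of the third join consecutive
    positions and cross nothing.\<close>
  show "\<not> crosses (fan_pos n) e f"
    using split by (elim disjE exE conjE) (auto simp: crosses_doubleton fan_pos_def)
  fix v assume v: "v \<in> e" "v \<in> f"
  show "e = f"
    using split
  proof (elim disjE exE conjE)
    fix i j :: nat
    assume ij: "i mod 2 = j mod 2" "e = {Inr {i, Suc i}, Inr {Suc i, Suc (Suc i)}}"
      "f = {Inr {j, Suc j}, Inr {Suc j, Suc (Suc j)}}"
    \<comment> \<open>\<open>case_sum id Min\<close> reads off the index of a vertex. Edges sharing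
      a vertex have indices differing by at most one, and equal parity makes them equal.\<close>
    have "case_sum id Min v = i \<or> case_sum id Min v = Suc i" using v(1) unfolding ij by auto
    moreover have "case_sum id Min v = j \<or> case_sum id Min v = Suc j" using v(2) unfolding ij by auto
    ultimately have "i = j \<or> i = Suc j \<or> j = Suc i" by linarith
    then have "i = j" using ij(1) by (auto simp: mod_Suc split: if_splits)
    then show ?thesis using ij by simp
  next
    fix i j assume ij: "e = {Inl i, Inr {i, Suc i}}" "f = {Inl j, Inr {j, Suc j}}"
    have "case_sum id Min v = i" using v(1) unfolding ij by auto
    moreover have "case_sum id Min v = j" using v(2) unfolding ij by auto
    ultimately show ?thesis using ij by simp
  next
    fix i j assume ij: "e = {Inl (Suc i), Inr {i, Suc i}}" "f = {Inl (Suc j), Inr {j, Suc j}}"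
    \<comment> \<open>The shift by one makes both ends of this kind of edge yield
      \<open>i\<close>.\<close>
    have "case_sum (\<lambda>l. l - 1) Min v = i" using v(1) unfolding ij by auto
    moreover have "case_sum (\<lambda>l. l - 1) Min v = j" using v(2) unfolding ij by auto
    ultimately show ?thesis using ij by simp
  qed
qed

section \<open>The cases of an empty \<open>H\<close>, \<open>n = 1\<close>, \<open>n = 2\<close>
  and \<open>n \<ge> 3\<close>\<close>

theorem theorem3p4:
  fixes n :: nat and H :: "'b ugraph"
  assumes "n \<ge> 1"
    and "simple_graph H"
    and "bipartite H"
    and "dispersable H"
  shows "dispersable (Q_sum (path_graph n) H)"
proof (cases "verts H = {}")
  case True
  have "edges H = {}" using simple_graph_edgeE[OF assms(2)] True by blast
  then have "matching_book_embedding (Q_sum (path_graph n) H) 0 (\<lambda>_. 0) (\<lambda>_. 0)"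
    using True by (auto simp: matching_book_embedding_def Q_sum_def)
  then show ?thesis
    using dispersableI simple_graph_Q_sum simple_graph_path assms(2) by blast
next
  case False
  let ?P = "path_graph n" and ?D = "max_degree H"
  let ?\<Delta> = "max_degree (Q_sum ?P H)"
  note P = simple_graph_path[of n]
  note Q = simple_graph_Q_graph[OF P]
  obtain posH pageH where emb_H: "matching_book_embedding H ?D posH pageH"
    using dispersable_embedding assms by blast
  note embedding = Q_sum_embedding[OF P assms(2,3) emb_H]
  have deg_v: "?D + card W \<le> ?\<Delta>"
    if "v < n" "\<And>w. w \<in> W \<Longrightarrow> {Inl v, w} \<in> edges (Q_graph ?P)" for v W
  proof -
    have "v \<in> verts ?P" using that(1) by (simp add: path_graph_def)
    from max_degree_Q_sum_Inl[OF P assms(2) False this] show ?thesis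
      using card_le_degree[OF Q that(2)] by (meson add_le_cancel_left le_trans)
  qed
  have deg_e: "card W \<le> ?\<Delta>"
    if "Suc i < n" "\<And>w. w \<in> W \<Longrightarrow> {Inr {i, Suc i}, w} \<in> edges (Q_graph ?P)" for i W
  proof -
    have "{i, Suc i} \<in> edges ?P" using that(1) by (auto simp: path_graph_def)
    from max_degree_Q_sum_Inr[OF P assms(2) False this] show ?thesis
      using card_le_degree[OF Q that(2)] by (meson le_trans)
  qed
  have VE: "{Inl i, Inr {i, Suc i}} \<in> edges (Q_graph ?P)"
      "{Inl (Suc i), Inr {i, Suc i}} \<in> edges (Q_graph ?P)"
      "{Inr {i, Suc i}, Inl i} \<in> edges (Q_graph ?P)"
      "{Inr {i, Suc i}, Inl (Suc i)} \<in> edges (Q_graph ?P)" if "Suc i < n" for i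
    using that unfolding edges_Q_path by (auto simp: insert_commute)
  have EE: "{Inr {i, Suc i}, Inr {Suc i, Suc (Suc i)}} \<in> edges (Q_graph ?P)"
      "{Inr {Suc i, Suc (Suc i)}, Inr {i, Suc i}} \<in> edges (Q_graph ?P)" if "Suc (Suc i) < n" for i
    using that unfolding edges_Q_path by (auto simp: insert_commute)
  have "\<exists>k pos page. matching_book_embedding (Q_sum ?P H) k pos page \<and> k \<le> ?\<Delta>"
  proof -
    consider "n = 1" | "n = 2" | "n \<ge> 3" using assms(1) by linarith
    then show ?thesis
    proof cases
      case 1
      \<comment> \<open>\<open>Q(P_1)\<close> has no edges, so its page function is
        arbitrary.\<close>
      have "matching_book_embedding (Q_graph ?P) ?D (fan_pos n) (\<lambda>_. 0)"
        unfolding matching_book_embedding_iff[OF Q] edges_Q_path verts_Q_path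
        using 1 by (auto simp: inj_on_def)
      then have "\<exists>pos page. matching_book_embedding (Q_sum ?P H) ?D pos page"
        by (rule embedding[where c = "\<lambda>_ i. i"]) (use 1 in \<open>auto simp: edges_Q_path\<close>)
      moreover have "?D \<le> ?\<Delta>" using deg_v[of 0 "{}"] 1 by simp
      ultimately show ?thesis by blast
    next
      case 2
      \<comment> \<open>The maximum matters when \<open>H\<close> has no edges:
        \<open>Q(P_2)\<close> alone already needs two pages.\<close>
      define M where "M = max ?D 1"
      define posQ :: "nat + nat set \<Rightarrow> nat" where "posQ = case_sum (\<lambda>i. 2 * i) (\<lambda>_. 1)"
      define pageQ :: "(nat + nat set) set \<Rightarrow> nat" where "pageQ S = (if Inl 0 \<in> S then M else 0)" for S
      define c where "c v i = (if v = 1 \<and> i = 0 then M else i)" for v i :: nat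
      have edges: "edges (Q_graph ?P) = {{Inl 0, Inr {0, 1}}, {Inl 1, Inr {0, 1}}}"
        unfolding edges_Q_path using 2 by auto
      have "M \<ge> 1" "?D \<le> M" by (auto simp: M_def)
      have "matching_book_embedding (Q_graph ?P) (M + 1) posQ pageQ"
        unfolding matching_book_embedding_iff[OF Q] edges verts_Q_path
        using 2 \<open>M \<ge> 1\<close>
        by (auto simp: inj_on_def posQ_def pageQ_def crosses_doubleton)
      then have emb: "\<exists>pos page. matching_book_embedding (Q_sum ?P H) (M + 1) pos page"
      proof (rule embedding[where c = c])
        fix v w i j
        assume "v \<in> verts ?P" "w \<in> verts ?P" "i < ?D" "j < ?D" "c v i = c w j"
        then show "i = j" using \<open>?D \<le> M\<close> by (auto simp: c_def split: if_splits)
      next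
        fix v i x y
        assume *: "v \<in> verts ?P" "i < ?D" "{x, y} \<in> edges (Q_graph ?P)" "pageQ {x, y} = c v i"
        \<comment> \<open>On page \<open>M\<close> the edge of \<open>Q(P_2)\<close> occupies
          positions 0 and 1 and the copy of \<open>H\<close> sits at position 2; on page
          \<open>0\<close> the edge occupies 1 and 2 and the copy sits at 0.\<close>
        then have "v = 0 \<or> v = 1" using 2 by (auto simp: path_graph_def)
        then show "Inl v \<noteq> x \<and> \<not> (posQ x < posQ (Inl v) \<and> posQ (Inl v) < posQ y)"
          using * \<open>?D \<le> M\<close> unfolding edges
          by (auto simp: doubleton_eq_iff c_def posQ_def pageQ_def split: if_splits)
      qed (use \<open>?D \<le> M\<close> in \<open>auto simp: c_def\<close>)
      have "?D + 1 \<le> ?\<Delta>" using deg_v[of 0 "{Inr {0, 1}}"] VE[of 0] 2 by simp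
      \<comment> \<open>The inserted vertex has two neighbours, which settles the case
        \<open>?D = 0\<close>.\<close>
      moreover have "card {Inl 0 :: nat + nat set, Inl 1} \<le> ?\<Delta>"
        by (rule deg_e[of 0]) (use VE[of 0] 2 in auto)
      ultimately have "M + 1 \<le> ?\<Delta>" by (auto simp: M_def)
      with emb show ?thesis by blast
    next
      case 3
      \<comment> \<open>At least as many pages as the edges between inserted vertices
        require.\<close>
      define M where "M = max ?D (if n = 3 then 1 else 2)"
      have "?D \<le> M" by (auto simp: M_def)
      have "matching_book_embedding (Q_graph ?P) (M + 2) (fan_pos n) (fan_page n M)"
        by (rule fan_embedding) (auto simp: M_def)
      then have "\<exists>pos page. matching_book_embedding (Q_sum ?P H) (M + 2) pos page"
      proof (rule embedding[where c = "\<lambda>_ i. i"])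
        fix v i x y
        assume *: "v \<in> verts ?P" "i < ?D" "{x, y} \<in> edges (Q_graph ?P)" "fan_page n M {x, y} = i"
        \<comment> \<open>Pages \<open>M\<close> and \<open>M + 1\<close> carry no edge of
          \<open>H\<close>, so only an edge between inserted vertices remains; these all come after
          the old vertices in the block.\<close>
        then obtain j where "{x, y} = {Inr {j, Suc j}, Inr {Suc j, Suc (Suc j)}}"
          using \<open>?D \<le> M\<close> unfolding edges_Q_path by (fastforce simp: fan_page_simps)
        then show "Inl v \<noteq> x \<and>
            \<not> (fan_pos n x < fan_pos n (Inl v) \<and> fan_pos n (Inl v) < fan_pos n y)"
          by (auto simp: doubleton_eq_iff fan_pos_def)
      qed (use \<open>?D \<le> M\<close> in auto)
      moreover have "M + 2 \<le> ?\<Delta>"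
      proof -
        \<comment> \<open>Three witnesses match the maximum in \<open>M\<close>: \<open>v_1\<close>
          gives \<open>?D + 2\<close>, \<open>e_0\<close> gives 3, and for \<open>n \<ge> 4\<close>
          the vertex \<open>e_1\<close> gives 4.\<close>
        have "?D + card {Inr {0, Suc 0} :: nat + nat set, Inr {Suc 0, Suc (Suc 0)}} \<le> ?\<Delta>"
          by (rule deg_v[of 1]) (use VE[of 0] VE[of 1] 3 in auto)
        moreover have "card {Inl 0, Inl (Suc 0), Inr {Suc 0, Suc (Suc 0)}} \<le> ?\<Delta>"
          by (rule deg_e[of 0]) (use VE[of 0] EE[of 0] 3 in auto)
        moreover have "card {Inl (Suc 0), Inl (Suc (Suc 0)), Inr {0, Suc 0},
            Inr {Suc (Suc 0), Suc (Suc (Suc 0))}} \<le> ?\<Delta>" if "n \<noteq> 3"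
          by (rule deg_e[of 1]) (use VE[of 1] EE[of 0] EE[of 1] 3 that in auto)
        ultimately show ?thesis by (auto simp: M_def doubleton_eq_iff)
      qed
      ultimately show ?thesis by blast
    qed
  qed
  then show ?thesis
    using dispersableI[OF simple_graph_Q_sum[OF P assms(2)]] by blast
qed

end
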